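(* Let $H$ be a finite-dimensional real Hilbert space and let $f:H\to\mathbb{R}$ be convex, twice continuously differentiable and bounded below, with nonempty set of minimizers $X_\star$ and minimal value $f_\star$. Assume that for some $L_\nu>0$ and $\nu\in[0,1]$ one has $\|\nabla^2 f(x)-\nabla^2 f(y)\|\le L_\nu\|x-y\|^\nu$ for all $x,y\in H$, and that $D:=\sup\{\operatorname{dist}(x,X_\star): x\in H,\ f(x)\le f(x_0)\}<\infty$. Let $(x_k)_k$ be generated by the parameterized quadratic trust-region framework (described in the context) started at $x_0$, and let $s_k^\star\in H$ denote a global minimizer of $m_k$ over $\{s:\|s\|\le\Delta_k\}$. Define $k_{\mathrm{cvx}}(\varepsilon):=\min\{k\in\mathbb{N}: f(x_k)-f_\star\le\varepsilon\}$. Assume: (i) there exists $\kappa_{\mathrm{cvx}}\in(0,1]$ such that $m_k(0)-m_k(s_k)\ge\kappa_{\mathrm{cvx}}\,(m_k(0)-m_k(s_k^\star))$ for all $k\in\mathbb{N}$; (ii) there exists a constant $\beta_{\mathrm{cvx}}\in(0,\beta]$ such that, for all $k\in\mathbb{N}$, $\Delta_k\le\beta_{\mathrm{cvx}}F_k^\alpha$ implies $\rho_k^\vartheta\ge\eta_2$. Define $$\mu_{\mathrm{cvx}}:=\min\left\{\gamma_1\beta_{\mathrm{cvx}},\frac{\Delta_0}{F_0^\alpha}\right\},\qquad C_{\mathrm{cvx}}:=\frac{\eta_1(1+\eta_2)\kappa_{\mathrm{cvx}}\mu_{\mathrm{cvx}}}{2D}.$$ Then for every $\varepsilon>0$ $$k_{\mathrm{cvx}}(\varepsilon)\le\left(1+\frac{\log(\gamma_3)}{|\log(\gamma_2)|}\right)\left(\frac{1}{\alpha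 C_{\mathrm{cvx}}\varepsilon^{1/(1+\nu)}}\right)+\frac{1}{|\log(\gamma_2)|}\log_+\!\left(\frac{\Delta_0}{\mu_{\mathrm{cvx}}\,\varepsilon^{1/(1+\nu)}}\right)+1,$$ and in particular $k_{\mathrm{cvx}}(\varepsilon)=\mathcal{O}\bigl(\varepsilon^{-\frac1{1+\nu}}\bigr)$ as $\varepsilon\downarrow0$.
   Context: $\mathbb{N}=\{0,1,2,\dots\}$, $\log$ is the natural logarithm and $\log_+(x):=\max(0,\log x)$. Write $g_k:=\nabla f(x_k)$, $H_k:=\nabla^2 f(x_k)$, $m_k(s):=f(x_k)+\langle g_k,s\rangle+\tfrac12\langle H_ks,s\rangle$ and $F_k:=f(x_k)-f_\star$. Constants: $$\alpha:=\frac1{1+\nu},\qquad C_f:=\frac{L_\nu}{(1+\nu)(2+\nu)},\qquad \beta:=\min\left\{\frac{D}{F_0^\alpha},\left(\frac{1-\eta_2}{2C_fD}\right)^\alpha\right\}.$$ Parameterized quadratic trust-region framework. Inputs: $x_0\in H$, $\Delta_0>0$, $\vartheta\ge0$, constants $0<\eta_1\le\eta_2<1$, $0<\gamma_1\le\gamma_2<1\le\gamma_3$. For $k=0,1,2,\dots$: if $\|g_k\|=0$, terminate and return $x_k$. Otherwise compute a step $s_k\in H$ with $\|s_k\|\le\Delta_k$ (an approximate minimizer of $m_k$ over $\{\|s\|\le\Delta_k\}$, with accuracy as required in the claim) and set $$\rho_k^\vartheta:=\frac{f(x_k)-f(x_k+s_k)}{m_k(0)-m_k(s_k)+\frac{\vartheta}{2}\min\{\|\nabla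 f(x_k)\|,\|\nabla f(x_k+s_k)\|\}\|s_k\|}.$$ Set $x_{k+1}=x_k+s_k$ if $\rho_k^\vartheta\ge\eta_1$ and $x_{k+1}=x_k$ otherwise. Choose $\Delta_{k+1}$ arbitrarily in $[\gamma_1\Delta_k,\gamma_2\Delta_k]$ if $\rho_k^\vartheta<\eta_1$, in $[\gamma_2\Delta_k,\Delta_k]$ if $\eta_1\le\rho_k^\vartheta<\eta_2$, and in $[\Delta_k,\gamma_3\Delta_k]$ if $\rho_k^\vartheta\ge\eta_2$. Standing convention: the method does not terminate finitely, i.e. $\|\nabla f(x_k)\|>0$ and $F_k>0$ for all $k\in\mathbb{N}$. The notation $K(\varepsilon)=\mathcal{O}(\phi(\varepsilon))$ as $\varepsilon\downarrow0$ means: there are $C>0,\varepsilon_0>0$ independent of $\varepsilon$ (possibly depending on problem data and algorithmic parameters) with $K(\varepsilon)\le C\phi(\varepsilon)$ for all $\varepsilon\in(0,\varepsilon_0]$. *)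

theory Defs
  imports "HOL-Analysis.Analysis" "HOL-Library.Landau_Symbols"
begin

text \<open>The gradient and the Hessian are total functions; they carry meaning only at points where
  \<open>f\<close>, respectively the gradient of \<open>f\<close>, is differentiable. The Hessian is a bounded linear
  operator, so \<open>norm\<close> is the operator norm on it.\<close>

definition gradient :: "('a::euclidean_space \<Rightarrow> real) \<Rightarrow> 'a \<Rightarrow> 'a" where
  "gradient f x = (THE d. GDERIV f x :> d)"

definition hessian :: "('a::euclidean_space \<Rightarrow> real) \<Rightarrow> 'a \<Rightarrow> 'a \<Rightarrow>\<^sub>L 'a" where
  "hessian f x = Blinfun (frechet_derivative (gradient f) (at x))"

definition twice_continuously_differentiable :: "('a::euclidean_space \<Rightarrow> real) \<Rightarrow> bool" where
  "twice_continuously_differentiable f \<longleftrightarrow>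
     (\<forall>x. f differentiable at x) \<and>
     (\<forall>x. gradient f differentiable at x) \<and>
     continuous_on UNIV (hessian f)"

lemma gradient_eqI:
  assumes "GDERIV f x :> d"
  shows "gradient f x = d"
  unfolding gradient_def
proof (rule the_equality)
  fix e assume "GDERIV f x :> e"
  then have "(\<lambda>h. h \<bullet> e) = (\<lambda>h. h \<bullet> d)"
    using assms has_derivative_unique unfolding gderiv_def by blast
  then show "e = d"
    by (metis vector_eq_ldot)
qed (fact assms)

lemma gderiv_gradient:
  fixes f :: "'a::euclidean_space \<Rightarrow> real"
  assumes "f differentiable at x"
  shows "GDERIV f x :> gradient f x"
proof -
  obtain f' where f': "(f has_derivative f') (at x)"
    using assms by (auto simp: differentiable_def)
  then interpret linear f'
    by (rule has_derivative_linear)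
  have "f' = (\<lambda>h. h \<bullet> adjoint f' 1)"
    using adjoint_works[OF linear_axioms] by (auto simp: fun_eq_iff)
  then have "GDERIV f x :> adjoint f' 1"
    using f' by (simp add: gderiv_def)
  then show ?thesis
    using gradient_eqI by metis
qed

lemma has_derivative_gradient_hessian:
  assumes "gradient f differentiable at x"
  shows "(gradient f has_derivative blinfun_apply (hessian f x)) (at x)"
  using assms unfolding hessian_def
  by (metis bounded_linear_Blinfun_apply frechet_derivative_works has_derivative_bounded_linear)

definition minimizers :: "('a \<Rightarrow> real) \<Rightarrow> 'a set" where
  "minimizers f = {z. is_arg_min f (\<lambda>_. True) z}"

definition quadratic_model :: "('a::euclidean_space \<Rightarrow> real) \<Rightarrow> 'a \<Rightarrow> 'a \<Rightarrow> real" where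
  "quadratic_model f x s = f x + gradient f x \<bullet> s + (1/2) * (hessian f x s \<bullet> s)"

definition tr_ratio :: "real \<Rightarrow> ('a::euclidean_space \<Rightarrow> real) \<Rightarrow> 'a \<Rightarrow> 'a \<Rightarrow> real" where
  "tr_ratio \<theta> f x s =
     (f x - f (x + s)) /
     (quadratic_model f x 0 - quadratic_model f x s +
      \<theta> / 2 * min (norm (gradient f x)) (norm (gradient f (x + s))) * norm s)"

text \<open>\<open>x\<close>, \<open>s\<close> and \<open>\<Delta>\<close> are the iterates, steps and radii of an infinite run of the framework, so
  the stopping test never fires. The accuracy of the step \<open>s k\<close> within the trust region is not part
  of the framework.\<close>

definition tr_run ::
  "('a::euclidean_space \<Rightarrow> real) \<Rightarrow> 'a \<Rightarrow> real \<Rightarrow> real \<Rightarrow> real \<Rightarrow> real \<Rightarrow> real \<Rightarrow> real \<Rightarrow> real \<Rightarrow>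
   (nat \<Rightarrow> 'a) \<Rightarrow> (nat \<Rightarrow> 'a) \<Rightarrow> (nat \<Rightarrow> real) \<Rightarrow> bool" where
  "tr_run f x\<^sub>0 \<Delta>\<^sub>0 \<theta> \<eta>\<^sub>1 \<eta>\<^sub>2 \<gamma>\<^sub>1 \<gamma>\<^sub>2 \<gamma>\<^sub>3 x s \<Delta> \<longleftrightarrow>
     x 0 = x\<^sub>0 \<and> \<Delta> 0 = \<Delta>\<^sub>0 \<and>
     (\<forall>k. norm (gradient f (x k)) \<noteq> 0 \<and>
          norm (s k) \<le> \<Delta> k \<and>
          (let \<rho> = tr_ratio \<theta> f (x k) (s k) in
             x (Suc k) = (if \<rho> \<ge> \<eta>\<^sub>1 then x k + s k else x k) \<and>
             \<Delta> (Suc k) \<in>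
               (if \<rho> < \<eta>\<^sub>1 then {\<gamma>\<^sub>1 * \<Delta> k .. \<gamma>\<^sub>2 * \<Delta> k}
                else if \<rho> < \<eta>\<^sub>2 then {\<gamma>\<^sub>2 * \<Delta> k .. \<Delta> k}
                else {\<Delta> k .. \<gamma>\<^sub>3 * \<Delta> k})))"

definition k_cvx :: "('a \<Rightarrow> real) \<Rightarrow> real \<Rightarrow> (nat \<Rightarrow> 'a) \<Rightarrow> real \<Rightarrow> nat" where
  "k_cvx f f_star x \<epsilon> = (LEAST k. f (x k) - f_star \<le> \<epsilon>)"

definition ln_plus :: "real \<Rightarrow> real" where
  "ln_plus t = max 0 (ln t)"

end

(* On a successful iteration, comparing the step with the point at distance at most mu F_k^alpha on
   the segment from x_k to a nearest minimizer gives F_k - F_(k+1) >= C F_k^(1+alpha); here convexity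
   bounds f along the segment, and the Hoelder condition on the Hessian bounds the model error.
   Hence F_k^(-alpha) grows by at least alpha C per success, which bounds the number of successes.
   Failures are bounded because each one shrinks the radius by gamma_2, each success enlarges it by
   at most gamma_3, and the radius never falls below mu F_k^alpha. *)

theory Submission imports Defs begin

lemma INF_eq_minimizer_value:
  fixes f :: "'a \<Rightarrow> real"
  assumes "z \<in> minimizers f"
  shows "(INF y. f y) = f z"
  using assms by (intro cInf_eq_minimum) (auto simp: minimizers_def is_arg_min_linorder)

text \<open>The set is an intersection of sublevel sets of a continuous function. Closedness later
  supplies a nearest minimizer and a positive distance from any non-minimizer.\<close>

lemma closed_minimizers:
  fixes f :: "'a::topological_space \<Rightarrow> real"
  assumes "continuous_on UNIV f"
  shows "closed (minimizers f)"
proof -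
  have eq: "minimizers f = (\<Inter>y. {z. f z \<le> f y})"
    by (auto simp: minimizers_def is_arg_min_linorder)
  show ?thesis
    unfolding eq by (intro closed_INT ballI closed_Collect_le assms continuous_on_const)
qed

section \<open>The quadratic model and its error under a Hoelder continuous Hessian\<close>

lemma quadratic_model_zero [simp]: "quadratic_model f x 0 = f x"
  by (simp add: quadratic_model_def blinfun.zero_right)

text \<open>A one-sided Taylor estimate along the segment from \<open>x\<close> to
  \<open>x + s\<close>: adding a suitable multiple of \<open>t powr (2 + \<nu>)\<close> to the
  Taylor error gives a function with nonnegative second derivative, and two monotonicity arguments
  replace integration.\<close>

lemma quadratic_model_upper_bound:
  fixes f :: "'a::euclidean_space \<Rightarrow> real"
  assumes C2: "twice_continuously_differentiable f" and nu: "0 \<le> \<nu>"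
    and holder: "\<And>y z. norm (hessian f y - hessian f z) \<le> L * norm (y - z) powr \<nu>"
  shows "quadratic_model f x s \<le> f (x + s) + L / ((1 + \<nu>) * (2 + \<nu>)) * norm s powr (2 + \<nu>)"
proof (cases "s = 0")
  case True
  then show ?thesis by simp
next
  case False
  define n where "n = norm s"
  have n: "n > 0" using False by (simp add: n_def)
  \<comment> \<open>Differentiating the power term of \<open>h\<close> twice leaves
    \<open>A * t powr \<nu>\<close>; this \<open>A\<close> makes that exactly the Hoelder bound on
    the change of the Hessian form at \<open>s\<close>.\<close>
  define A where "A = L * n powr (2 + \<nu>)"
  define h where "h t = f (x + t *\<^sub>R s) - f x - t * (gradient f x \<bullet> s)
      - t\<^sup>2 / 2 * (hessian f x s \<bullet> s) + A / ((1 + \<nu>) * (2 + \<nu>)) * t powr (2 + \<nu>)" for t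
  define h' where "h' t = gradient f (x + t *\<^sub>R s) \<bullet> s - gradient f x \<bullet> s
      - t * (hessian f x s \<bullet> s) + A / (1 + \<nu>) * t powr (1 + \<nu>)" for t
  have df: "(f has_derivative (\<lambda>v. v \<bullet> gradient f y)) (at y)" for y
    using gderiv_gradient[of f y] C2
    by (auto simp: twice_continuously_differentiable_def gderiv_def)
  have dg: "(gradient f has_derivative blinfun_apply (hessian f y)) (at y)" for y
    using has_derivative_gradient_hessian[of f y] C2
    by (auto simp: twice_continuously_differentiable_def)
  have line: "((\<lambda>t. x + t *\<^sub>R s) has_derivative (\<lambda>u. u *\<^sub>R s)) (at t)" for t :: real
    by (auto intro!: derivative_eq_intros)
  have df_line: "((\<lambda>t. f (x + t *\<^sub>R s)) has_real_derivative gradient f (x + t *\<^sub>R s) \<bullet> s) (at t)" for t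
    using has_derivative_compose[OF line df]
    by (simp add: has_field_derivative_def inner_commute mult_commute_abs)
  have dg_line: "((\<lambda>t. gradient f (x + t *\<^sub>R s) \<bullet> s) has_real_derivative
      hessian f (x + t *\<^sub>R s) s \<bullet> s) (at t)" for t
    using has_derivative_inner_left[OF has_derivative_compose[OF line dg], of s]
    by (simp add: has_field_derivative_def blinfun.scaleR_right mult_commute_abs)
  \<comment> \<open>Derivatives are taken only for \<open>t > 0\<close>, where the power rule
    applies; at the endpoint 0 continuity suffices for monotonicity.\<close>
  have h_deriv: "(h has_real_derivative h' t) (at t)" if "t > 0" for t
  proof -
    have "((\<lambda>t. A / ((1 + \<nu>) * (2 + \<nu>)) * t powr (2 + \<nu>)) has_real_derivative
        A / ((1 + \<nu>) * (2 + \<nu>)) * ((2 + \<nu>) * t powr (1 + \<nu>))) (at t)"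
      using DERIV_cmult[OF has_real_derivative_powr[OF that, of "2 + \<nu>"],
          of "A / ((1 + \<nu>) * (2 + \<nu>))"] by (simp add: algebra_simps)
    also have "A / ((1 + \<nu>) * (2 + \<nu>)) * ((2 + \<nu>) * t powr (1 + \<nu>)) = A / (1 + \<nu>) * t powr (1 + \<nu>)"
      using nu by (simp add: divide_simps)
    finally have powr_deriv: "((\<lambda>t. A / ((1 + \<nu>) * (2 + \<nu>)) * t powr (2 + \<nu>)) has_real_derivative
        A / (1 + \<nu>) * t powr (1 + \<nu>)) (at t)" .
    have "((\<lambda>t. f (x + t *\<^sub>R s) - f x - t * (gradient f x \<bullet> s) - t\<^sup>2 / 2 * (hessian f x s \<bullet> s))
        has_real_derivative (gradient f (x + t *\<^sub>R s) \<bullet> s - gradient f x \<bullet> s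
          - t * (hessian f x s \<bullet> s))) (at t)"
      by (auto intro!: derivative_eq_intros df_line)
    from DERIV_add[OF this powr_deriv] show ?thesis
      unfolding h_def h'_def .
  qed
  have h'_deriv: "(h' has_real_derivative
      (hessian f (x + t *\<^sub>R s) s \<bullet> s - hessian f x s \<bullet> s + A * t powr \<nu>)) (at t)" if "t > 0" for t
  proof -
    have "((\<lambda>t. A / (1 + \<nu>) * t powr (1 + \<nu>)) has_real_derivative
        A / (1 + \<nu>) * ((1 + \<nu>) * t powr \<nu>)) (at t)"
      using DERIV_cmult[OF has_real_derivative_powr[OF that, of "1 + \<nu>"],
          of "A / (1 + \<nu>)"] by (simp add: algebra_simps)
    also have "A / (1 + \<nu>) * ((1 + \<nu>) * t powr \<nu>) = A * t powr \<nu>"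
      using nu by (simp add: field_simps)
    finally have powr_deriv: "((\<lambda>t. A / (1 + \<nu>) * t powr (1 + \<nu>)) has_real_derivative
        A * t powr \<nu>) (at t)" .
    have "((\<lambda>t. gradient f (x + t *\<^sub>R s) \<bullet> s - gradient f x \<bullet> s - t * (hessian f x s \<bullet> s))
        has_real_derivative (hessian f (x + t *\<^sub>R s) s \<bullet> s - hessian f x s \<bullet> s)) (at t)"
      by (auto intro!: derivative_eq_intros dg_line)
    from DERIV_add[OF this powr_deriv] show ?thesis
      unfolding h'_def .
  qed
  have h''_nonneg: "hessian f (x + t *\<^sub>R s) s \<bullet> s - hessian f x s \<bullet> s + A * t powr \<nu> \<ge> 0"
    if "t > 0" for t
  proof -
    have "\<bar>(hessian f (x + t *\<^sub>R s) - hessian f x) s \<bullet> s\<bar>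
        \<le> norm ((hessian f (x + t *\<^sub>R s) - hessian f x) s) * norm s"
      by (rule Cauchy_Schwarz_ineq2)
    also have "\<dots> \<le> (norm (hessian f (x + t *\<^sub>R s) - hessian f x) * norm s) * norm s"
      by (intro mult_right_mono norm_blinfun) auto
    also have "\<dots> \<le> (L * norm (x + t *\<^sub>R s - x) powr \<nu> * norm s) * norm s"
      by (intro mult_right_mono holder) auto
    also have "\<dots> = A * t powr \<nu>"
      using that n
      by (simp add: A_def n_def powr_mult powr_add power2_eq_square)
    finally show ?thesis
      by (simp add: blinfun.diff_left inner_diff_left)
  qed
  have cont_f: "continuous_on {0..t} (\<lambda>t. f (x + t *\<^sub>R s))" for t
    by (rule DERIV_continuous_on, rule DERIV_subset[OF df_line]) auto
  have cont_g: "continuous_on {0..t} (\<lambda>t. gradient f (x + t *\<^sub>R s) \<bullet> s)" for t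
    by (rule DERIV_continuous_on, rule DERIV_subset[OF dg_line]) auto
  have cont_powr: "continuous_on {0..t} (\<lambda>t::real. t powr a)" if "a > 0" for a t
    using that by (intro continuous_on_powr' continuous_intros) auto
  have h'_nonneg: "h' t \<ge> 0" if "t > 0" for t
  proof -
    have "h' 0 \<le> h' t"
    proof (rule DERIV_nonneg_imp_increasing_open[of 0 t h'])
      show "0 \<le> t" using that by simp
      show "continuous_on {0..t} h'"
        unfolding h'_def using nu by (intro continuous_on_add continuous_on_diff continuous_on_mult
          continuous_on_divide continuous_on_power continuous_on_const continuous_on_id cont_g cont_powr) auto
    qed (use h'_deriv h''_nonneg in blast)+
    \<comment> \<open>\<open>h' 0\<close> vanishes: the gradient terms cancel and 0 to a positive
      power is 0.\<close>
    then show ?thesis by (simp add: h'_def)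
  qed
  have "h 0 \<le> h 1"
  proof (rule DERIV_nonneg_imp_increasing_open[of 0 1 h])
    show "(0::real) \<le> 1" by simp
    show "continuous_on {0..1} h"
      unfolding h_def using nu by (intro continuous_on_add continuous_on_diff continuous_on_mult
          continuous_on_divide continuous_on_power continuous_on_const continuous_on_id cont_f cont_powr) auto
  qed (use h_deriv h'_nonneg in blast)+
  \<comment> \<open>\<open>h 0\<close> is 0, and \<open>h 1\<close> is the right side of the claim
    minus the left.\<close>
  then show ?thesis
    by (simp add: h_def A_def n_def quadratic_model_def)
qed

text \<open>By convexity \<open>f\<close> lies below its chord at
  \<open>x + t *\<^sub>R (z - x)\<close>, and the model exceeds \<open>f\<close> there by at most
  the Taylor error. An upper bound \<open>R\<close> stands in for the distance, so that a uniform
  bound over all iterates can be inserted.\<close>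

lemma model_decrease_towards_point:
  fixes f :: "'a::euclidean_space \<Rightarrow> real"
  assumes f_convex: "convex_on UNIV f" and C2: "twice_continuously_differentiable f"
    and nu: "0 \<le> \<nu>" and L: "0 \<le> L"
    and holder: "\<And>y z. norm (hessian f y - hessian f z) \<le> L * norm (y - z) powr \<nu>"
    and t: "0 \<le> t" "t \<le> 1" and R: "norm (z - x) \<le> R"
  shows "t * (f x - f z) - L / ((1 + \<nu>) * (2 + \<nu>)) * (t * R) powr (2 + \<nu>)
    \<le> quadratic_model f x 0 - quadratic_model f x (t *\<^sub>R (z - x))"
proof -
  have "x + t *\<^sub>R (z - x) = (1 - t) *\<^sub>R x + t *\<^sub>R z"
    by (simp add: algebra_simps)
  then have "f (x + t *\<^sub>R (z - x)) \<le> (1 - t) * f x + t * f z"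
    using convex_onD[OF f_convex t] by simp
  moreover have "quadratic_model f x (t *\<^sub>R (z - x)) \<le> f (x + t *\<^sub>R (z - x))
      + L / ((1 + \<nu>) * (2 + \<nu>)) * norm (t *\<^sub>R (z - x)) powr (2 + \<nu>)"
    by (rule quadratic_model_upper_bound[OF C2 nu holder])
  moreover have "L / ((1 + \<nu>) * (2 + \<nu>)) * norm (t *\<^sub>R (z - x)) powr (2 + \<nu>)
      \<le> L / ((1 + \<nu>) * (2 + \<nu>)) * (t * R) powr (2 + \<nu>)"
    using t nu L R by (intro mult_left_mono powr_mono2) (auto intro: mult_left_mono)
  ultimately show ?thesis
    by (simp add: algebra_simps)
qed

section \<open>Counting successful and unsuccessful iterations\<close>

text \<open>The negative power is convex and decreasing, so on the interval its slope is smallest in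
  magnitude at the right end \<open>b\<close>; the mean value theorem does the rest.\<close>

lemma powr_minus_tangent_bound:
  fixes a b \<alpha> :: real
  assumes "0 < a" "a \<le> b" "0 < \<alpha>"
  shows "\<alpha> * (b - a) * b powr (- \<alpha> - 1) \<le> a powr (- \<alpha>) - b powr (- \<alpha>)"
proof (cases "a = b")
  case False
  then have "a < b" using assms by simp
  then obtain z where z: "a < z" "z < b"
      "b powr (- \<alpha>) - a powr (- \<alpha>) = (b - a) * (- \<alpha> * z powr (- \<alpha> - 1))"
    using MVT2[of a b "\<lambda>u. u powr (- \<alpha>)" "\<lambda>u. - \<alpha> * u powr (- \<alpha> - 1)"]
      has_real_derivative_powr[of _ "- \<alpha>"] assms(1) by force
  have "b powr (- \<alpha> - 1) \<le> z powr (- \<alpha> - 1)"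
    using z assms by (intro powr_mono2') auto
  then have "\<alpha> * (b - a) * b powr (- \<alpha> - 1) \<le> \<alpha> * (b - a) * z powr (- \<alpha> - 1)"
    using assms by (intro mult_left_mono) auto
  then show ?thesis using z(3) by (simp add: algebra_simps)
qed simp

text \<open>Two potentials telescope: \<open>F k powr (- \<alpha>)\<close> limits the successes and
  \<open>ln (\<Delta> k)\<close> the failures. \<open>K\<close> is any index whose value is still
  above the tolerance, so the first index within it is at most one larger than the bound.\<close>

lemma success_failure_count:
  fixes F \<Delta> :: "nat \<Rightarrow> real" and success :: "nat \<Rightarrow> bool"
  assumes F_pos: "\<And>k. F k > 0" and alpha: "\<alpha> > 0" and C: "C > 0" and mu: "\<mu> > 0"
    and gammas: "0 < \<gamma>\<^sub>2" "\<gamma>\<^sub>2 < 1" "1 \<le> \<gamma>\<^sub>3"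
    and F_success: "\<And>k. success k \<Longrightarrow> C * F k powr (1 + \<alpha>) \<le> F k - F (Suc k)"
    and F_failure: "\<And>k. \<not> success k \<Longrightarrow> F (Suc k) = F k"
    and \<Delta>_success: "\<And>k. success k \<Longrightarrow> \<Delta> (Suc k) \<le> \<gamma>\<^sub>3 * \<Delta> k"
    and \<Delta>_failure: "\<And>k. \<not> success k \<Longrightarrow> \<Delta> (Suc k) \<le> \<gamma>\<^sub>2 * \<Delta> k"
    and \<Delta>_lower: "\<And>k. \<mu> * F k powr \<alpha> \<le> \<Delta> k"
    and eps: "0 < \<epsilon>" "\<epsilon> < F K"
  shows "real K \<le> (1 + ln \<gamma>\<^sub>3 / \<bar>ln \<gamma>\<^sub>2\<bar>) * (1 / (\<alpha> * C * \<epsilon> powr \<alpha>))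
    + 1 / \<bar>ln \<gamma>\<^sub>2\<bar> * ln (\<Delta> 0 / (\<mu> * \<epsilon> powr \<alpha>))"
proof -
  define n where "n K = (\<Sum>k<K. of_bool (success k) :: real)" for K
  have n_Suc: "n (Suc k) = n k + of_bool (success k)" for k
    by (simp add: n_def)
  have \<Delta>_pos: "\<Delta> k > 0" for k
    by (rule less_le_trans[OF _ \<Delta>_lower]) (use F_pos[of k] mu in simp)
  have ln2: "ln \<gamma>\<^sub>2 < 0" and ln3: "ln \<gamma>\<^sub>3 \<ge> 0" using gammas by auto
  have F_count: "F 0 powr (- \<alpha>) + \<alpha> * C * n k \<le> F k powr (- \<alpha>)" for k
  proof (induction k)
    case 0
    then show ?case by (simp add: n_def)
  next
    case (Suc k)
    show ?case
    proof (cases "success k")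
      case True
      have pos: "F k powr (1 + \<alpha>) > 0" using F_pos[of k] by simp
      have le: "F (Suc k) \<le> F k"
        using F_success[OF True] mult_pos_pos[OF C pos] by linarith
      \<comment> \<open>The tangent factor cancels the power in the guaranteed decrease, so the gain
        per success is independent of \<open>k\<close>.\<close>
      have "F k powr (1 + \<alpha>) * F k powr (- \<alpha> - 1) = 1"
        using F_pos[of k] by (simp flip: powr_add)
      then have "\<alpha> * C = \<alpha> * (C * F k powr (1 + \<alpha>)) * F k powr (- \<alpha> - 1)"
        by simp
      also have "\<dots> \<le> \<alpha> * (F k - F (Suc k)) * F k powr (- \<alpha> - 1)"
        using F_success[OF True] alpha by (intro mult_right_mono mult_left_mono) auto
      also have "\<dots> \<le> F (Suc k) powr (- \<alpha>) - F k powr (- \<alpha>)"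
        by (rule powr_minus_tangent_bound[OF F_pos le alpha])
      finally show ?thesis
        using Suc True by (simp add: n_Suc algebra_simps)
    next
      case False
      then show ?thesis using Suc by (simp add: n_Suc F_failure)
    qed
  qed
  have \<Delta>_count: "ln (\<Delta> k) \<le> ln (\<Delta> 0) + n k * ln \<gamma>\<^sub>3 + (real k - n k) * ln \<gamma>\<^sub>2" for k
  proof (induction k)
    case 0
    then show ?case by (simp add: n_def)
  next
    case (Suc k)
    show ?case
    proof (cases "success k")
      case True
      have "ln (\<Delta> (Suc k)) \<le> ln (\<gamma>\<^sub>3 * \<Delta> k)"
        using \<Delta>_success[OF True] \<Delta>_pos by (intro ln_mono) auto
      also have "\<dots> = ln \<gamma>\<^sub>3 + ln (\<Delta> k)"
        using gammas \<Delta>_pos[of k] by (simp add: ln_mult)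
      finally show ?thesis
        using Suc True by (simp add: n_Suc algebra_simps)
    next
      case False
      have "ln (\<Delta> (Suc k)) \<le> ln (\<gamma>\<^sub>2 * \<Delta> k)"
        using \<Delta>_failure[OF False] \<Delta>_pos by (intro ln_mono) auto
      also have "\<dots> = ln \<gamma>\<^sub>2 + ln (\<Delta> k)"
        using gammas \<Delta>_pos[of k] by (simp add: ln_mult)
      finally show ?thesis
        using Suc False by (simp add: n_Suc algebra_simps)
    qed
  qed
  define N where "N = 1 / (\<alpha> * C * \<epsilon> powr \<alpha>)"
  \<comment> \<open>The nonnegative initial potential is dropped.\<close>
  have "\<alpha> * C * n K \<le> F K powr (- \<alpha>)"
    using F_count[of K] powr_ge_zero[of "F 0" "- \<alpha>"] by linarith
  also have "\<dots> \<le> \<epsilon> powr (- \<alpha>)"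
    using eps alpha by (intro powr_mono2') auto
  finally have n_le: "n K \<le> N"
    using alpha C eps by (simp add: N_def powr_minus divide_simps ac_simps)
  have "\<mu> * \<epsilon> powr \<alpha> \<le> \<mu> * F K powr \<alpha>"
    using eps alpha mu by (intro mult_left_mono powr_mono2) auto
  also have "\<dots> \<le> \<Delta> K" by (rule \<Delta>_lower)
  finally have "ln (\<mu> * \<epsilon> powr \<alpha>) \<le> ln (\<Delta> K)"
    using mu eps by (intro ln_mono) auto
  moreover have "ln (\<Delta> 0 / (\<mu> * \<epsilon> powr \<alpha>)) = ln (\<Delta> 0) - ln (\<mu> * \<epsilon> powr \<alpha>)"
    using \<Delta>_pos[of 0] mu eps by (simp add: ln_div)
  \<comment> \<open>Since \<open>ln \<gamma>\<^sub>2\<close> is negative, comparing the upper and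
    lower bounds on \<open>ln (\<Delta> K)\<close> isolates the number \<open>real K - n K\<close>
    of failures.\<close>
  ultimately have "(real K - n K) * \<bar>ln \<gamma>\<^sub>2\<bar> \<le> n K * ln \<gamma>\<^sub>3 + ln (\<Delta> 0 / (\<mu> * \<epsilon> powr \<alpha>))"
    using \<Delta>_count[of K] ln2 by (simp add: algebra_simps)
  then have "real K - n K \<le> (n K * ln \<gamma>\<^sub>3 + ln (\<Delta> 0 / (\<mu> * \<epsilon> powr \<alpha>))) / \<bar>ln \<gamma>\<^sub>2\<bar>"
    using ln2 by (subst pos_le_divide_eq) auto
  then have "real K \<le> (1 + ln \<gamma>\<^sub>3 / \<bar>ln \<gamma>\<^sub>2\<bar>) * n K + 1 / \<bar>ln \<gamma>\<^sub>2\<bar> * ln (\<Delta> 0 / (\<mu> * \<epsilon> powr \<alpha>))"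
    by (simp add: add_divide_distrib algebra_simps)
  \<comment> \<open>The coefficient counts a success together with the failures that its radius
    enlargement can offset.\<close>
  moreover have "(1 + ln \<gamma>\<^sub>3 / \<bar>ln \<gamma>\<^sub>2\<bar>) * n K \<le> (1 + ln \<gamma>\<^sub>3 / \<bar>ln \<gamma>\<^sub>2\<bar>) * N"
    using n_le ln3 by (intro mult_left_mono) auto
  ultimately show ?thesis by (simp add: N_def)
qed

text \<open>This crude bound absorbs the logarithmic term into the power of \<epsilon> in the
  asymptotic statement. At 0 it rests on the convention \<open>ln 0 = 0\<close>.\<close>

lemma ln_plus_le_self: "0 \<le> t \<Longrightarrow> ln_plus t \<le> t"
  using less_imp_le[OF ln_less_self[of t]] by (cases "t = 0") (auto simp: ln_plus_def)


theorem theorem8: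
  fixes f :: "'a::euclidean_space \<Rightarrow> real"
    and x\<^sub>0 :: 'a
    and x s s_star :: "nat \<Rightarrow> 'a"
    and \<Delta> F :: "nat \<Rightarrow> real"
    and X_star :: "'a set"
    and f_star L \<nu> D \<alpha> C\<^sub>f \<beta> \<beta>_cvx \<kappa>_cvx \<mu>_cvx C_cvx :: real
    and \<Delta>\<^sub>0 \<theta> \<eta>\<^sub>1 \<eta>\<^sub>2 \<gamma>\<^sub>1 \<gamma>\<^sub>2 \<gamma>\<^sub>3 :: real
  assumes f_convex: "convex_on UNIV f"
    and f_C2: "twice_continuously_differentiable f"
    and f_bdd_below: "bdd_below (range f)"
    and X_star: "X_star = minimizers f" "X_star \<noteq> {}"
    and f_star: "f_star = (INF z. f z)"
    and L_pos: "L > 0"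
    and nu: "0 \<le> \<nu>" "\<nu> \<le> 1"
    and hessian_holder:
      "\<And>y z. norm (hessian f y - hessian f z) \<le> L * norm (y - z) powr \<nu>"
    and D_finite: "bdd_above {infdist y X_star | y. f y \<le> f x\<^sub>0}"
    and D: "D = Sup {infdist y X_star | y. f y \<le> f x\<^sub>0}"
    and inputs: "\<Delta>\<^sub>0 > 0" "\<theta> \<ge> 0"
    and etas: "0 < \<eta>\<^sub>1" "\<eta>\<^sub>1 \<le> \<eta>\<^sub>2" "\<eta>\<^sub>2 < 1"
    and gammas: "0 < \<gamma>\<^sub>1" "\<gamma>\<^sub>1 \<le> \<gamma>\<^sub>2" "\<gamma>\<^sub>2 < 1" "1 \<le> \<gamma>\<^sub>3"
    and run: "tr_run f x\<^sub>0 \<Delta>\<^sub>0 \<theta> \<eta>\<^sub>1 \<eta>\<^sub>2 \<gamma>\<^sub>1 \<gamma>\<^sub>2 \<gamma>\<^sub>3 x s \<Delta>"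
    and s_star: "\<And>k. is_arg_min (quadratic_model f (x k)) (\<lambda>t. norm t \<le> \<Delta> k) (s_star k)"
    and F: "\<And>k. F k = f (x k) - f_star"
    and F_pos: "\<And>k. F k > 0"
    and alpha: "\<alpha> = 1 / (1 + \<nu>)"
    and C_f: "C\<^sub>f = L / ((1 + \<nu>) * (2 + \<nu>))"
    and beta: "\<beta> = min (D / F 0 powr \<alpha>) (((1 - \<eta>\<^sub>2) / (2 * C\<^sub>f * D)) powr \<alpha>)"
    and kappa_cvx: "0 < \<kappa>_cvx" "\<kappa>_cvx \<le> 1"
    and model_decrease:
      "\<And>k. quadratic_model f (x k) 0 - quadratic_model f (x k) (s k) \<ge>
             \<kappa>_cvx * (quadratic_model f (x k) 0 - quadratic_model f (x k) (s_star k))"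
    and beta_cvx: "0 < \<beta>_cvx" "\<beta>_cvx \<le> \<beta>"
    and very_successful:
      "\<And>k. \<Delta> k \<le> \<beta>_cvx * F k powr \<alpha> \<Longrightarrow> tr_ratio \<theta> f (x k) (s k) \<ge> \<eta>\<^sub>2"
    and mu_cvx: "\<mu>_cvx = min (\<gamma>\<^sub>1 * \<beta>_cvx) (\<Delta>\<^sub>0 / F 0 powr \<alpha>)"
    and C_cvx: "C_cvx = \<eta>\<^sub>1 * (1 + \<eta>\<^sub>2) * \<kappa>_cvx * \<mu>_cvx / (2 * D)"
  shows "(\<forall>\<epsilon>>0.
            (\<exists>k. f (x k) - f_star \<le> \<epsilon>) \<and>
            real (k_cvx f f_star x \<epsilon>) \<le>
              (1 + ln \<gamma>\<^sub>3 / \<bar>ln \<gamma>\<^sub>2\<bar>) * (1 / (\<alpha> * C_cvx * \<epsilon> powr (1 / (1 + \<nu>)))) +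
              1 / \<bar>ln \<gamma>\<^sub>2\<bar> * ln_plus (\<Delta>\<^sub>0 / (\<mu>_cvx * \<epsilon> powr (1 / (1 + \<nu>)))) + 1) \<and>
         (\<lambda>\<epsilon>. real (k_cvx f f_star x \<epsilon>)) \<in> O[at_right 0](\<lambda>\<epsilon>. \<epsilon> powr (- (1 / (1 + \<nu>))))"
proof -

  \<comment> \<open>Consequences of the assumptions and the run\<close>
  have alpha_pos: "\<alpha> > 0" and alpha_nu: "\<alpha> * (1 + \<nu>) = 1"
    using alpha nu by auto
  obtain z\<^sub>0 where z\<^sub>0: "z\<^sub>0 \<in> X_star" using X_star by blast
  have f_star_eq: "f z = f_star" if "z \<in> X_star" for z
    using INF_eq_minimizer_value[of z f] that X_star(1) f_star by simp
  have cont: "continuous_on UNIV f"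
    using f_C2 unfolding twice_continuously_differentiable_def
    by (simp add: continuous_at_imp_continuous_on differentiable_imp_continuous_within)
  have closed: "closed X_star"
    using closed_minimizers[OF cont] X_star(1) by simp
  have run_x: "x 0 = x\<^sub>0" and run_\<Delta>: "\<Delta> 0 = \<Delta>\<^sub>0"
    using run by (auto simp: tr_run_def)
  define \<rho> where "\<rho> k = tr_ratio \<theta> f (x k) (s k)" for k
  have x_Suc: "x (Suc k) = (if \<rho> k \<ge> \<eta>\<^sub>1 then x k + s k else x k)"
    and \<Delta>_Suc: "\<Delta> (Suc k) \<in> (if \<rho> k < \<eta>\<^sub>1 then {\<gamma>\<^sub>1 * \<Delta> k .. \<gamma>\<^sub>2 * \<Delta> k}
                else if \<rho> k < \<eta>\<^sub>2 then {\<gamma>\<^sub>2 * \<Delta> k .. \<Delta> k}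
                else {\<Delta> k .. \<gamma>\<^sub>3 * \<Delta> k})"
    and s_le: "norm (s k) \<le> \<Delta> k" for k
    using run unfolding tr_run_def \<rho>_def Let_def by blast+
  have \<Delta>_nonneg: "\<Delta> k \<ge> 0" for k
    using s_le[of k] norm_ge_zero order_trans by blast
  have s_star_le: "quadratic_model f (x k) (s_star k) \<le> quadratic_model f (x k) t"
    if "norm t \<le> \<Delta> k" for k t
    using s_star[of k] that by (auto simp: is_arg_min_linorder)

  \<comment> \<open>Monotone values and distance to the minimizers\<close>
  have decrease: "\<eta>\<^sub>1 * (quadratic_model f (x k) 0 - quadratic_model f (x k) (s k)) \<le> F k - F (Suc k)"
    and model_nonneg: "0 \<le> quadratic_model f (x k) 0 - quadratic_model f (x k) (s k)"
    if "\<rho> k \<ge> \<eta>\<^sub>1" for k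
  proof -
    \<comment> \<open>The zero step is feasible, so the optimal model decrease is
      nonnegative.\<close>
    have "0 \<le> \<kappa>_cvx * (quadratic_model f (x k) 0 - quadratic_model f (x k) (s_star k))"
      using s_star_le[of 0 k] \<Delta>_nonneg[of k] kappa_cvx by simp
    then show nonneg: "0 \<le> quadratic_model f (x k) 0 - quadratic_model f (x k) (s k)"
      using model_decrease[of k] by linarith
    define m where "m = quadratic_model f (x k) 0 - quadratic_model f (x k) (s k)"
    define q where "q = \<theta> / 2 * min (norm (gradient f (x k))) (norm (gradient f (x k + s k))) * norm (s k)"
    have q: "q \<ge> 0" using inputs by (simp add: q_def)
    have rho: "\<rho> k = (f (x k) - f (x k + s k)) / (m + q)"
      by (simp add: \<rho>_def tr_ratio_def m_def q_def)
    \<comment> \<open>Division by zero yields 0, which would contradict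
      \<open>\<rho> k \<ge> \<eta>\<^sub>1 > 0\<close>.\<close>
    have "m + q \<noteq> 0" using rho that etas by auto
    then have "m + q > 0" using nonneg q by (simp add: m_def)
    then have "\<eta>\<^sub>1 * (m + q) \<le> f (x k) - f (x k + s k)"
      using that rho by (simp add: pos_le_divide_eq)
    \<comment> \<open>The term \<open>q\<close> coming from \<open>\<theta>\<close> only enlarges
      the denominator, so dropping it weakens the decrease safely.\<close>
    moreover have "\<eta>\<^sub>1 * m \<le> \<eta>\<^sub>1 * (m + q)" using etas q by simp
    ultimately show "\<eta>\<^sub>1 * (quadratic_model f (x k) 0 - quadratic_model f (x k) (s k)) \<le> F k - F (Suc k)"
      using that by (simp add: x_Suc F m_def)
  qed
  have F_Suc_le: "F (Suc k) \<le> F k" for k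
  proof (cases "\<rho> k \<ge> \<eta>\<^sub>1")
    case True
    have "0 \<le> \<eta>\<^sub>1 * (quadratic_model f (x k) 0 - quadratic_model f (x k) (s k))"
      using model_nonneg[OF True] etas by (intro mult_nonneg_nonneg) auto
    then show ?thesis using decrease[OF True] by linarith
  next
    case False
    then show ?thesis by (simp add: x_Suc F)
  qed
  have F_le_0: "F k \<le> F 0" for k
    by (induction k) (auto intro: order_trans[OF F_Suc_le])
  \<comment> \<open>Monotonicity keeps every iterate in the initial sublevel set, over which
    \<open>D\<close> is the supremum.\<close>
  have infdist_le: "infdist (x k) X_star \<le> D" for k
    unfolding D by (rule cSup_upper[OF _ D_finite]) (use F_le_0[of k] in \<open>auto simp: F run_x\<close>)
  have D_pos: "D > 0"
  proof -
    have "x 0 \<notin> X_star" using f_star_eq F_pos[of 0] by (auto simp: F)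
    then have "infdist (x 0) X_star > 0"
      using closed z\<^sub>0 infdist_pos_not_in_closed by blast
    then show ?thesis using infdist_le[of 0] by linarith
  qed
  have C_f_pos: "C\<^sub>f > 0" using L_pos nu by (simp add: C_f)
  have mu_pos: "\<mu>_cvx > 0"
    using gammas beta_cvx inputs F_pos[of 0] by (simp add: mu_cvx)
  have C_pos: "C_cvx > 0"
    using etas kappa_cvx mu_pos D_pos by (simp add: C_cvx)
  have mu_beta: "\<mu>_cvx \<le> \<beta>"
  proof -
    have "\<mu>_cvx \<le> \<gamma>\<^sub>1 * \<beta>_cvx" by (simp add: mu_cvx)
    also have "\<dots> \<le> \<beta>_cvx" using gammas beta_cvx by (simp add: mult_left_le_one_le)
    finally show ?thesis using beta_cvx by linarith
  qed

  \<comment> \<open>Lower bound on the trust-region radius\<close>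
  have powr_Suc_le: "F (Suc k) powr \<alpha> \<le> F k powr \<alpha>" for k
    using F_pos[of "Suc k"] F_Suc_le alpha_pos by (intro powr_mono2) auto
  have \<Delta>_lower: "\<mu>_cvx * F k powr \<alpha> \<le> \<Delta> k" for k
  proof (induction k)
    case 0
    have "\<mu>_cvx \<le> \<Delta>\<^sub>0 / F 0 powr \<alpha>" by (simp add: mu_cvx)
    then show ?case using F_pos[of 0] by (simp add: pos_le_divide_eq run_\<Delta>)
  next
    case (Suc k)
    have step: "\<mu>_cvx * F (Suc k) powr \<alpha> \<le> \<mu>_cvx * F k powr \<alpha>"
      using powr_Suc_le mu_pos by (intro mult_left_mono) auto
    \<comment> \<open>A radius below the threshold in \<open>very_successful\<close> cannot shrink
      at the next update; one above it shrinks at most by \<open>\<gamma>\<^sub>1\<close>, which the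
      first entry of the minimum in \<open>\<mu>_cvx\<close> anticipates. The second entry gave the
      base case.\<close>
    show ?case
    proof (cases "\<Delta> k \<le> \<beta>_cvx * F k powr \<alpha>")
      case True
      then have "\<rho> k \<ge> \<eta>\<^sub>2" using very_successful by (simp add: \<rho>_def)
      then have "\<Delta> (Suc k) \<ge> \<Delta> k" using \<Delta>_Suc[of k] etas by auto
      then show ?thesis using Suc step by linarith
    next
      case False
      have "\<mu>_cvx * F k powr \<alpha> \<le> \<gamma>\<^sub>1 * \<beta>_cvx * F k powr \<alpha>"
        by (intro mult_right_mono) (auto simp: mu_cvx)
      also have "\<dots> \<le> \<gamma>\<^sub>1 * \<Delta> k" using False gammas by (simp add: mult.assoc)
      also have "\<dots> \<le> \<Delta> (Suc k)"
      proof -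
        have "\<gamma>\<^sub>1 * \<Delta> k \<le> \<gamma>\<^sub>2 * \<Delta> k" "\<gamma>\<^sub>2 * \<Delta> k \<le> \<Delta> k"
          using gammas \<Delta>_nonneg[of k] by (auto intro: mult_right_mono simp: mult_left_le_one_le)
        then show ?thesis using \<Delta>_Suc[of k] by (auto split: if_splits)
      qed
      finally show ?thesis using step by linarith
    qed
  qed

  \<comment> \<open>Decrease at a successful iteration\<close>
  have F_success: "C_cvx * F k powr (1 + \<alpha>) \<le> F k - F (Suc k)" if "\<rho> k \<ge> \<eta>\<^sub>1" for k
  proof -
    obtain z where z: "z \<in> X_star" "infdist (x k) X_star = dist (x k) z"
      using infdist_attains_inf[OF closed] X_star(2) by blast
    have zD: "norm (z - x k) \<le> D"
      using infdist_le[of k] z(2) by (simp add: dist_norm norm_minus_commute)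
    define r where "r = \<mu>_cvx * F k powr \<alpha>"
    have r_pos: "r > 0" using mu_pos F_pos[of k] by (simp add: r_def)
    have r_D: "r \<le> D"
    proof -
      \<comment> \<open>The first entry of the minimum \<open>\<beta>\<close>, with
        \<open>F k \<le> F 0\<close>, keeps the fraction \<open>r / D\<close> of the segment at most
        1.\<close>
      have "r \<le> D / F 0 powr \<alpha> * F 0 powr \<alpha>"
        unfolding r_def using mu_beta mu_pos F_pos[of k] F_le_0[of k] alpha_pos D_pos
        by (intro mult_mono powr_mono2) (auto simp: beta)
      then show ?thesis using F_pos[of 0] by simp
    qed
    define t where "t = r / D"
    have t: "0 \<le> t" "t \<le> 1" "t * D = r" using r_pos r_D D_pos by (auto simp: t_def)
    \<comment> \<open>The second entry of \<open>\<beta>\<close> enters here; as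
      \<open>\<alpha> * (1 + \<nu>) = 1\<close>, the power \<open>1 + \<nu>\<close> undoes
      \<open>\<alpha>\<close>.\<close>
    have "\<mu>_cvx powr (1 + \<nu>) \<le> (((1 - \<eta>\<^sub>2) / (2 * C\<^sub>f * D)) powr \<alpha>) powr (1 + \<nu>)"
      using mu_beta mu_pos nu by (intro powr_mono2) (auto simp: beta)
    also have "\<dots> = (1 - \<eta>\<^sub>2) / (2 * C\<^sub>f * D)"
      using etas C_f_pos D_pos by (simp add: powr_powr alpha_nu)
    finally have mu_powr: "\<mu>_cvx powr (1 + \<nu>) \<le> (1 - \<eta>\<^sub>2) / (2 * C\<^sub>f * D)" .
    have "r powr (1 + \<nu>) = \<mu>_cvx powr (1 + \<nu>) * F k"
      using mu_pos F_pos[of k] by (simp add: r_def powr_mult powr_powr alpha_nu)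
    also have "\<dots> \<le> (1 - \<eta>\<^sub>2) / (2 * C\<^sub>f * D) * F k"
      using mu_powr F_pos[of k] by (intro mult_right_mono) auto
    finally have r_powr: "r powr (1 + \<nu>) \<le> (1 - \<eta>\<^sub>2) / (2 * C\<^sub>f * D) * F k" .
    have r_split: "r powr (2 + \<nu>) = r * r powr (1 + \<nu>)"
      using r_pos powr_add[of r 1 "1 + \<nu>"] by (simp add: add.assoc[symmetric])
    \<comment> \<open>The split-off factor \<open>r\<close> equals \<open>t * D\<close>, so
      \<open>D\<close> and \<open>C\<^sub>f\<close> cancel: the model error consumes at most the
      share \<open>(1 - \<eta>\<^sub>2) / 2\<close> of \<open>t * F k\<close>.\<close>
    have "C\<^sub>f * r powr (2 + \<nu>) \<le> C\<^sub>f * (r * ((1 - \<eta>\<^sub>2) / (2 * C\<^sub>f * D) * F k))"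
      unfolding r_split using r_pos C_f_pos by (intro mult_left_mono r_powr) auto
    also have "\<dots> = t * F k * ((1 - \<eta>\<^sub>2) / 2)"
      using C_f_pos D_pos by (simp add: t_def field_simps)
    finally have err: "C\<^sub>f * r powr (2 + \<nu>) \<le> t * F k * ((1 - \<eta>\<^sub>2) / 2)" .
    have "t * F k - C\<^sub>f * r powr (2 + \<nu>)
        \<le> quadratic_model f (x k) 0 - quadratic_model f (x k) (t *\<^sub>R (z - x k))"
      using model_decrease_towards_point[OF f_convex f_C2 nu(1) less_imp_le[OF L_pos]
          hessian_holder t(1,2) zD] t(3) f_star_eq[OF z(1)] by (simp add: F C_f)
    \<comment> \<open>The trial point is feasible: its length is at most \<open>t * D = r\<close>,
      which the radius bound dominates.\<close>
    moreover have "norm (t *\<^sub>R (z - x k)) \<le> \<Delta> k"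
    proof -
      have "norm (t *\<^sub>R (z - x k)) \<le> t * D" using mult_left_mono[OF zD t(1)] t(1) by simp
      then show ?thesis using \<Delta>_lower[of k] t(3) by (simp add: r_def)
    qed
    ultimately have "t * F k - C\<^sub>f * r powr (2 + \<nu>)
        \<le> quadratic_model f (x k) 0 - quadratic_model f (x k) (s_star k)"
      using s_star_le by fastforce
    \<comment> \<open>The remaining share is \<open>1 - (1 - \<eta>\<^sub>2) / 2\<close>, the source
      of the factor \<open>(1 + \<eta>\<^sub>2) / 2\<close> in \<open>C_cvx\<close>.\<close>
    then have "t * F k * ((1 + \<eta>\<^sub>2) / 2)
        \<le> quadratic_model f (x k) 0 - quadratic_model f (x k) (s_star k)"
      using err by (simp add: field_simps)
    from order_trans[OF mult_left_mono[OF this less_imp_le[OF kappa_cvx(1)]] model_decrease]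
    have "\<kappa>_cvx * (t * F k * ((1 + \<eta>\<^sub>2) / 2))
        \<le> quadratic_model f (x k) 0 - quadratic_model f (x k) (s k)" .
    from order_trans[OF mult_left_mono[OF this less_imp_le[OF etas(1)]] decrease[OF that]]
    have "\<eta>\<^sub>1 * (\<kappa>_cvx * (t * F k * ((1 + \<eta>\<^sub>2) / 2))) \<le> F k - F (Suc k)" .
    moreover have "F k powr (1 + \<alpha>) = F k * F k powr \<alpha>"
      using F_pos[of k] by (simp add: powr_add)
    then have "C_cvx * F k powr (1 + \<alpha>) = \<eta>\<^sub>1 * (\<kappa>_cvx * (t * F k * ((1 + \<eta>\<^sub>2) / 2)))"
      by (simp only: C_cvx t_def r_def divide_inverse inverse_mult_distrib
          mult.assoc mult.commute mult.left_commute)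
    ultimately show ?thesis by simp
  qed

  \<comment> \<open>The iteration bound\<close>
  define B where "B \<epsilon> = (1 + ln \<gamma>\<^sub>3 / \<bar>ln \<gamma>\<^sub>2\<bar>) * (1 / (\<alpha> * C_cvx * \<epsilon> powr \<alpha>)) +
              1 / \<bar>ln \<gamma>\<^sub>2\<bar> * ln_plus (\<Delta>\<^sub>0 / (\<mu>_cvx * \<epsilon> powr \<alpha>))" for \<epsilon>
  have ln3: "ln \<gamma>\<^sub>3 \<ge> 0" using gammas by simp
  have K_le: "real K \<le> B \<epsilon>" if "\<epsilon> > 0" "\<epsilon> < F K" for K \<epsilon>
  proof -
    have "real K \<le> (1 + ln \<gamma>\<^sub>3 / \<bar>ln \<gamma>\<^sub>2\<bar>) * (1 / (\<alpha> * C_cvx * \<epsilon> powr \<alpha>))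
        + 1 / \<bar>ln \<gamma>\<^sub>2\<bar> * ln (\<Delta> 0 / (\<mu>_cvx * \<epsilon> powr \<alpha>))"
    proof (rule success_failure_count[where success = "\<lambda>k. \<rho> k \<ge> \<eta>\<^sub>1" and F = F])
      fix k
      show "F (Suc k) = F k" if "\<not> \<eta>\<^sub>1 \<le> \<rho> k" using that by (simp add: x_Suc F)
      show "\<Delta> (Suc k) \<le> \<gamma>\<^sub>2 * \<Delta> k" if "\<not> \<eta>\<^sub>1 \<le> \<rho> k" using that \<Delta>_Suc[of k] by auto
      \<comment> \<open>A success with ratio below \<open>\<eta>\<^sub>2\<close> does not enlarge
        the radius, so \<open>1 \<le> \<gamma>\<^sub>3\<close> covers that case too.\<close>
      show "\<Delta> (Suc k) \<le> \<gamma>\<^sub>3 * \<Delta> k" if "\<eta>\<^sub>1 \<le> \<rho> k"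
        using that \<Delta>_Suc[of k] mult_right_mono[OF gammas(4) \<Delta>_nonneg[of k]]
        by (auto split: if_splits)
    qed (use F_pos alpha_pos C_pos mu_pos gammas F_success \<Delta>_lower that in auto)
    also have "\<dots> \<le> B \<epsilon>"
      unfolding B_def run_\<Delta> by (intro add_left_mono mult_left_mono) (auto simp: ln_plus_def)
    finally show ?thesis .
  qed
  \<comment> \<open>Otherwise every index would be at most \<open>B \<epsilon>\<close>. Existence
    also makes the \<open>LEAST\<close> in \<open>k_cvx\<close> meaningful.\<close>
  have ex: "\<exists>k. f (x k) - f_star \<le> \<epsilon>" if "\<epsilon> > 0" for \<epsilon>
  proof (rule ccontr)
    assume "\<not> ?thesis"
    then have "\<epsilon> < F k" for k
      by (auto simp: F not_le)
    from K_le[OF that this, of "Suc (nat \<lceil>B \<epsilon>\<rceil>)"] show False by linarith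
  qed
  have bound: "real (k_cvx f f_star x \<epsilon>) \<le> B \<epsilon> + 1" if "\<epsilon> > 0" for \<epsilon>
  proof (cases "k_cvx f f_star x \<epsilon>")
    case 0
    have "B \<epsilon> \<ge> 0"
      unfolding B_def using ln3 alpha_pos C_pos that
      by (intro add_nonneg_nonneg mult_nonneg_nonneg) (auto simp: ln_plus_def)
    then show ?thesis using 0 by simp
  next
    \<comment> \<open>The predecessor of the first hit is still above the tolerance and hence at
      most \<open>B \<epsilon>\<close>; this is the origin of the final 1.\<close>
    case (Suc K)
    then have "K < (LEAST k. f (x k) - f_star \<le> \<epsilon>)" by (simp add: k_cvx_def)
    then have "\<epsilon> < F K" using not_less_Least F not_le by metis
    then show ?thesis using K_le[OF that, of K] Suc by simp
  qed

  \<comment> \<open>Order of growth as \<epsilon> tends to 0\<close>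
  define M where "M = (1 + ln \<gamma>\<^sub>3 / \<bar>ln \<gamma>\<^sub>2\<bar>) / (\<alpha> * C_cvx) + 1 / \<bar>ln \<gamma>\<^sub>2\<bar> * (\<Delta>\<^sub>0 / \<mu>_cvx) + 1"
  have bigo: "(\<lambda>\<epsilon>. real (k_cvx f f_star x \<epsilon>)) \<in> O[at_right 0](\<lambda>\<epsilon>. \<epsilon> powr (- \<alpha>))"
  proof (rule bigoI)
    show "\<forall>\<^sub>F \<epsilon> in at_right 0. norm (real (k_cvx f f_star x \<epsilon>)) \<le> M * norm (\<epsilon> powr (- \<alpha>))"
    proof (rule eventually_at_rightI[of 0 1])
      fix \<epsilon> :: real assume "\<epsilon> \<in> {0<..<1}"
      then have eps: "0 < \<epsilon>" "\<epsilon> < 1" by auto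
      have "ln_plus (\<Delta>\<^sub>0 / (\<mu>_cvx * \<epsilon> powr \<alpha>)) \<le> \<Delta>\<^sub>0 / (\<mu>_cvx * \<epsilon> powr \<alpha>)"
        using inputs mu_pos by (intro ln_plus_le_self) auto
      then have "1 / \<bar>ln \<gamma>\<^sub>2\<bar> * ln_plus (\<Delta>\<^sub>0 / (\<mu>_cvx * \<epsilon> powr \<alpha>))
          \<le> 1 / \<bar>ln \<gamma>\<^sub>2\<bar> * (\<Delta>\<^sub>0 / (\<mu>_cvx * \<epsilon> powr \<alpha>))"
        by (intro mult_left_mono) auto
      \<comment> \<open>For \<open>\<epsilon> < 1\<close> the additive constant is also dominated by
        the power, which accounts for the summand 1 in \<open>M\<close>.\<close>
      moreover have "1 \<le> \<epsilon> powr (- \<alpha>)"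
        using eps alpha_pos powr_mono2'[of "- \<alpha>" \<epsilon> 1] by simp
      ultimately have "B \<epsilon> + 1 \<le> (1 + ln \<gamma>\<^sub>3 / \<bar>ln \<gamma>\<^sub>2\<bar>) * (1 / (\<alpha> * C_cvx * \<epsilon> powr \<alpha>)) +
          1 / \<bar>ln \<gamma>\<^sub>2\<bar> * (\<Delta>\<^sub>0 / (\<mu>_cvx * \<epsilon> powr \<alpha>)) + \<epsilon> powr (- \<alpha>)"
        unfolding B_def by linarith
      also have "\<dots> = M * \<epsilon> powr (- \<alpha>)"
        by (simp add: M_def powr_minus divide_inverse algebra_simps)
      finally show "norm (real (k_cvx f f_star x \<epsilon>)) \<le> M * norm (\<epsilon> powr (- \<alpha>))"
        using bound[OF eps(1)] by simp
    qed simp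
  qed
  show ?thesis
    using ex bound bigo unfolding B_def by (auto simp: alpha)
qed

end
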